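(* Let $k\geq 3$ and $n\geq 1$ be integers. (1) In the Y/N model, the number $q_k(n)$ exists (i.e. the majority problem for $n$ balls can be solved with some finite number of $k$-queries, for instance by asking all possible $k$-queries) if and only if $n\geq 2k-2$. (2) In the Pairing model, the number $q^{p}_k(n)$ exists if and only if $n\geq 2k-3$.
   Context: There are $n$ balls with distinct identities $1,\dots,n$, each colored with one of two colors (red or blue); the coloring is unknown to a questioner. A color is the majority color if strictly more than $n/2$ balls have it. The majority problem is: determine with certainty whether a majority color exists, and if it does, output a ball of the majority color. The questioner may adaptively ask $k$-queries: choose a set of $k$ distinct balls and receive an answer from an oracle (which answers consistently with the hidden coloring and may be adversarial). In the Y/N model the answer is YES if all $k$ balls have the same color and NO otherwise. In the Pairing model the answer is YES if all $k$ balls have the same color, and otherwise NO together with two balls of the queried set that have different colors (the oracle chooses which such pair). $q_k(n)$ (Y/N model) and $q^{p}_k(n)$ (Pairing model) denote the minimum number of $k$-queries that suffice in the worst case (over all colorings and oracle answers) to solve the majority problem for $n$ balls; such a number is said to exist if the problem can be solved with finitely many queries.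
   Formalization: The formal theorem assumes n ≥ 2 instead of n ≥ 1: for n = 1 the single ball always has the majority color, so zero queries suffice and both numbers exist although 1 < 2k−3, and the stated equivalences fail there. *)

theory Defs
  imports Complex_Main
begin

datatype color = Red | Blue

definition balls :: "nat \<Rightarrow> nat set" where
  "balls n = {1..n}"

definition majority_color :: "nat \<Rightarrow> (nat \<Rightarrow> color) \<Rightarrow> color \<Rightarrow> bool" where
  "majority_color n c x \<longleftrightarrow> real (card {b \<in> balls n. c b = x}) > real n / 2"

text \<open>The output \<open>None\<close> claims that there is no majority color; \<open>Some b\<close> claims that
  ball \<open>b\<close> has the majority color.\<close>

fun correct_output :: "nat \<Rightarrow> (nat \<Rightarrow> color) \<Rightarrow> nat option \<Rightarrow> bool" where
  "correct_output n c None \<longleftrightarrow> (\<nexists>x. majority_color n c x)"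
| "correct_output n c (Some b) \<longleftrightarrow> b \<in> balls n \<and> majority_color n c (c b)"

text \<open>Adaptive strategies are decision trees: the next query depends on the answers so far.
  The type variable is the type of answers of the model.\<close>

datatype 'a strategy = Output "nat option" | Query "nat set" "'a \<Rightarrow> 'a strategy"

primrec k_strategy :: "nat \<Rightarrow> nat \<Rightarrow> 'a strategy \<Rightarrow> bool" where
  "k_strategy k n (Output r) \<longleftrightarrow> True"
| "k_strategy k n (Query Q f) \<longleftrightarrow> Q \<subseteq> balls n \<and> card Q = k \<and> (\<forall>a. k_strategy k n (f a))"

text \<open>A model is given by the relation \<open>M c Q a\<close>: under the coloring \<open>c\<close> the oracle may answer
  the query \<open>Q\<close> by \<open>a\<close>.  Then \<open>play M c s m r\<close> says that, under the hidden coloring \<open>c\<close>, some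
  choice of admissible oracle answers makes the strategy \<open>s\<close> output \<open>r\<close> after exactly \<open>m\<close>
  queries.\<close>

inductive play ::
  "((nat \<Rightarrow> color) \<Rightarrow> nat set \<Rightarrow> 'a \<Rightarrow> bool) \<Rightarrow> (nat \<Rightarrow> color) \<Rightarrow> 'a strategy \<Rightarrow> nat \<Rightarrow> nat option \<Rightarrow> bool"
  for M :: "(nat \<Rightarrow> color) \<Rightarrow> nat set \<Rightarrow> 'a \<Rightarrow> bool" and c :: "nat \<Rightarrow> color" where
  "play M c (Output r) 0 r"
| "M c Q a \<Longrightarrow> play M c (f a) m r \<Longrightarrow> play M c (Query Q f) (Suc m) r"

definition queries_suffice ::
  "((nat \<Rightarrow> color) \<Rightarrow> nat set \<Rightarrow> 'a \<Rightarrow> bool) \<Rightarrow> nat \<Rightarrow> nat \<Rightarrow> nat \<Rightarrow> bool" where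
  "queries_suffice M k n q \<longleftrightarrow>
     (\<exists>s. k_strategy k n s \<and>
        (\<forall>c m r. play M c s m r \<longrightarrow> m \<le> q \<and> correct_output n c r))"

definition is_query_number ::
  "((nat \<Rightarrow> color) \<Rightarrow> nat set \<Rightarrow> 'a \<Rightarrow> bool) \<Rightarrow> nat \<Rightarrow> nat \<Rightarrow> nat \<Rightarrow> bool" where
  "is_query_number M k n q \<longleftrightarrow>
     queries_suffice M k n q \<and> (\<forall>q'. queries_suffice M k n q' \<longrightarrow> q \<le> q')"

definition monochromatic :: "(nat \<Rightarrow> color) \<Rightarrow> nat set \<Rightarrow> bool" where
  "monochromatic c Q \<longleftrightarrow> (\<forall>x\<in>Q. \<forall>y\<in>Q. c x = c y)"

datatype yn_answer = YES | NO

fun yn_model :: "(nat \<Rightarrow> color) \<Rightarrow> nat set \<Rightarrow> yn_answer \<Rightarrow> bool" where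
  "yn_model c Q YES \<longleftrightarrow> monochromatic c Q"
| "yn_model c Q NO \<longleftrightarrow> \<not> monochromatic c Q"

datatype pairing_answer = PYES | PNO "nat set"

fun pairing_model :: "(nat \<Rightarrow> color) \<Rightarrow> nat set \<Rightarrow> pairing_answer \<Rightarrow> bool" where
  "pairing_model c Q PYES \<longleftrightarrow> monochromatic c Q"
| "pairing_model c Q (PNO P) \<longleftrightarrow>
     \<not> monochromatic c Q \<and> (\<exists>x\<in>Q. \<exists>y\<in>Q. P = {x, y} \<and> c x \<noteq> c y)"

text \<open>A single ball always has the majority color, so for \<open>n = 1\<close> no query is needed, whatever
  \<open>k\<close> and the model are.  A threshold \<open>n \<ge> 2 * k - 2\<close> or \<open>n \<ge> 2 * k - 3\<close> with \<open>k \<ge> 3\<close>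
  for the existence of the query number can therefore only hold for \<open>n \<ge> 2\<close>.\<close>

lemma is_query_number_one_ball: "is_query_number M k 1 0"
proof -
  have "correct_output 1 c (Some 1)" for c
  proof -
    have "{b \<in> balls 1. c b = c 1} = {1}"
      by (auto simp: balls_def)
    then show ?thesis
      by (simp add: majority_color_def balls_def)
  qed
  then have "\<forall>c m r. play M c (Output (Some 1)) m r \<longrightarrow> m \<le> 0 \<and> correct_output 1 c r"
    by (auto elim: play.cases)
  then have "queries_suffice M k 1 0"
    unfolding queries_suffice_def by (intro exI[of _ "Output (Some 1)"]) simp
  then show ?thesis
    by (simp add: is_query_number_def)
qed

end

theory Submission
  imports Defs
begin

text \<open>
  Adaptivity is irrelevant for solvability: the problem is solvable iff the list of answers to all
  \<open>k\<close>-queries determines a correct output.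

  Y/N model.  If some query is answered YES, exchanging one of its balls for another ball reveals
  the whole partition.  If every answer is NO, both color classes have at most \<open>k - 1\<close> balls, which
  for \<open>n \<ge> 2 * k - 2\<close> excludes a majority, while for \<open>n \<le> 2 * k - 3\<close> it leaves all nearly balanced
  colorings possible.

  Pairing model.  For \<open>n \<le> 2 * k - 4\<close> the oracle can reveal only pairs between two fixed sets of
  \<open>(n - 2) div 2\<close> balls each, and the two or three remaining balls stay free.  For \<open>n = 2 * k - 3\<close>
  with all answers NO, consider the set \<open>F\<close> of all colorings with red majority that are compatible
  with the revealed pairs, and attach to each ball the set of those \<open>c \<in> F\<close> which color it red.
  The two balls of a revealed pair have complementary sets, so a coloring in \<open>F\<close> stays compatible
  if it is flipped on the balls with set \<open>X\<close> or \<open>F - X\<close>.  Compatible colorings have at most \<open>k - 1\<close>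
  red balls, so if \<open>X\<close> occurs more often than \<open>F - X\<close>, no such flip may turn \<open>X\<close> red, i.e.
  \<open>X = F\<close>: every ball with set \<open>X\<close> is a majority ball.
\<close>

section \<open>Solvability without adaptivity\<close>

text \<open>Here \<open>h\<close> is an oracle whose answer depends on the query alone, not on the
  history. Such oracles are general enough: any strategy can be played against \<open>h\<close>, and
  asking each query once yields such an \<open>h\<close>.\<close>

definition compatible ::
  "((nat \<Rightarrow> color) \<Rightarrow> nat set \<Rightarrow> 'a \<Rightarrow> bool) \<Rightarrow> nat \<Rightarrow> nat \<Rightarrow> (nat set \<Rightarrow> 'a) \<Rightarrow> (nat \<Rightarrow> color) \<Rightarrow> bool"
  where "compatible M k n h c \<longleftrightarrow> (\<forall>Q. Q \<subseteq> balls n \<longrightarrow> card Q = k \<longrightarrow> M c Q (h Q))"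

fun ask_all :: "nat set list \<Rightarrow> (nat set \<Rightarrow> 'a) \<Rightarrow> ((nat set \<Rightarrow> 'a) \<Rightarrow> nat option) \<Rightarrow> 'a strategy" where
  "ask_all [] h g = Output (g h)"
| "ask_all (Q # Qs) h g = Query Q (\<lambda>a. ask_all Qs (h(Q := a)) g)"

lemma k_strategy_ask_all:
  "(\<And>Q. Q \<in> set Qs \<Longrightarrow> Q \<subseteq> balls n \<and> card Q = k) \<Longrightarrow> k_strategy k n (ask_all Qs h g)"
  by (induction Qs arbitrary: h) auto

text \<open>\<open>D\<close> makes the induction work: it collects the queries whose recorded
  answers are already admissible. Asking one of them again overwrites its entry by another
  admissible answer.\<close>

lemma play_ask_all:
  assumes "play M c (ask_all Qs h g) m r" "\<forall>Q\<in>D. M c Q (h Q)"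
  shows "m = length Qs \<and> (\<exists>h'. r = g h' \<and> (\<forall>Q\<in>D \<union> set Qs. M c Q (h' Q)))"
  using assms
proof (induction Qs arbitrary: h m D)
  case Nil
  then show ?case by (auto elim: play.cases)
next
  case (Cons Q Qs)
  from Cons.prems(1) obtain a m' where m: "m = Suc m'" and a: "M c Q a"
    and p: "play M c (ask_all Qs (h(Q := a)) g) m' r"
    by (auto elim: play.cases)
  have "\<forall>Q'\<in>insert Q D. M c Q' ((h(Q := a)) Q')"
    using a Cons.prems(2) by auto
  from Cons.IH[OF p this] show ?case
    using m by simp
qed

text \<open>The answers \<open>h\<close> single out one path through the tree, so all compatible
  colorings share the leaf \<open>r\<close>. The quantifier order matters: \<open>r\<close> is
  chosen before \<open>c\<close>.\<close>

lemma play_following_answers: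
  assumes "k_strategy k n s"
  shows "\<exists>r. \<forall>c. compatible M k n h c \<longrightarrow> (\<exists>m. play M c s m r)"
  using assms
proof (induction s)
  case (Output r)
  then show ?case by (auto intro: play.intros)
next
  case (Query Q f)
  have "k_strategy k n (f (h Q))"
    using Query.prems by simp
  then obtain r where "\<forall>c. compatible M k n h c \<longrightarrow> (\<exists>m. play M c (f (h Q)) m r)"
    using Query.IH[of "f (h Q)"] by auto
  moreover have "M c Q (h Q)" if "compatible M k n h c" for c
    using that Query.prems by (simp add: compatible_def)
  ultimately show ?case
    by (meson play.intros(2))
qed

lemma query_number_exists_iff:
  "(\<exists>q. is_query_number M k n q) \<longleftrightarrow>
    (\<forall>h. \<exists>r. \<forall>c. compatible M k n h c \<longrightarrow> correct_output n c r)"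
proof
  assume "\<exists>q. is_query_number M k n q"
  then obtain s where s: "k_strategy k n s"
    and ok: "\<And>c m r. play M c s m r \<Longrightarrow> correct_output n c r"
    unfolding is_query_number_def queries_suffice_def by blast
  show "\<forall>h. \<exists>r. \<forall>c. compatible M k n h c \<longrightarrow> correct_output n c r"
  proof
    fix h
    obtain r where "\<And>c. compatible M k n h c \<Longrightarrow> \<exists>m. play M c s m r"
      using play_following_answers[OF s] by blast
    then show "\<exists>r. \<forall>c. compatible M k n h c \<longrightarrow> correct_output n c r"
      using ok by blast
  qed
next
  assume "\<forall>h. \<exists>r. \<forall>c. compatible M k n h c \<longrightarrow> correct_output n c r"
  from choice[OF this] obtain g where g: "\<And>h c. compatible M k n h c \<Longrightarrow> correct_output n c (g h)"
    by blast
  have "finite {Q. Q \<subseteq> balls n \<and> card Q = k}"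
    by (simp add: balls_def)
  from finite_list[OF this] obtain Qs where Qs: "set Qs = {Q. Q \<subseteq> balls n \<and> card Q = k}" ..
  \<comment> \<open>The initial table may be \<open>undefined\<close>: each entry at a
    \<open>k\<close>-query is overwritten before \<open>g\<close> is applied.\<close>
  define s where "s = ask_all Qs undefined g"
  have "k_strategy k n s"
    unfolding s_def by (rule k_strategy_ask_all) (use Qs in auto)
  moreover have "m \<le> length Qs \<and> correct_output n c r" if "play M c s m r" for c m r
  proof -
    from play_ask_all[OF that[unfolded s_def], of "{}"] obtain h
      where "m = length Qs" "r = g h" "\<forall>Q\<in>set Qs. M c Q (h Q)"
      by auto
    then show ?thesis
      using g[of h c] Qs by (auto simp: compatible_def)
  qed
  ultimately have "queries_suffice M k n (length Qs)"
    unfolding queries_suffice_def by blast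
  then have "is_query_number M k n (LEAST q. queries_suffice M k n q)"
    unfolding is_query_number_def by (auto intro: LeastI Least_le)
  then show "\<exists>q. is_query_number M k n q" ..
qed

section \<open>Color classes\<close>

abbreviation color_class :: "nat \<Rightarrow> (nat \<Rightarrow> color) \<Rightarrow> color \<Rightarrow> nat set" where
  "color_class n c x \<equiv> {b \<in> balls n. c b = x}"

lemma finite_balls [simp]: "finite (balls n)"
  by (simp add: balls_def)

lemma card_balls [simp]: "card (balls n) = n"
  by (simp add: balls_def)

lemma majority_color_iff: "majority_color n c x \<longleftrightarrow> n < 2 * card (color_class n c x)"
  unfolding majority_color_def by linarith

lemma majority_color_attained:
  assumes "majority_color n c x"
  obtains b where "b \<in> balls n" "c b = x"
proof -
  have "color_class n c x \<noteq> {}"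
    using assms by (metis card.empty majority_color_iff mult_0_right not_less_zero)
  then show thesis
    using that by blast
qed

lemma card_color_classes: "card (color_class n c Red) + card (color_class n c Blue) = n"
proof -
  have "balls n = color_class n c Red \<union> color_class n c Blue"
    using color.exhaust by auto
  moreover have "color_class n c Red \<inter> color_class n c Blue = {}"
    by auto
  ultimately show ?thesis
    using card_Un_disjoint[of "color_class n c Red" "color_class n c Blue"] card_balls[of n] by simp
qed

text \<open>With only two colors, comparing every ball with one reference ball fixes the whole
  partition.\<close>

lemma color_eq_cong: "(x = z) = (x' = z') \<Longrightarrow> (y = z) = (y' = z') \<Longrightarrow> (x = y) = (x' = y')"
  for x y z x' y' z' :: color
  by (cases x; cases y; cases z; cases x'; cases y'; cases z') auto

text \<open>Correctness depends only on the partition into color classes, not on which class is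
  called red.\<close>

lemma correct_output_cong:
  assumes "\<And>x y. x \<in> balls n \<Longrightarrow> y \<in> balls n \<Longrightarrow> (c x = c y) = (c' x = c' y)"
  shows "correct_output n c r \<longleftrightarrow> correct_output n c' r"
proof -
  have *: "majority_color n c (c b) \<longleftrightarrow> majority_color n c' (c' b)" if "b \<in> balls n" for b
  proof -
    have "color_class n c (c b) = color_class n c' (c' b)"
      using assms that by auto
    then show ?thesis
      by (simp add: majority_color_iff)
  qed
  show ?thesis
  proof (cases r)
    case None
    have "(\<exists>x. majority_color n d x) \<longleftrightarrow> (\<exists>b\<in>balls n. majority_color n d (d b))" for d
      by (metis majority_color_attained)
    then show ?thesis
      using None * by simp
  next
    case (Some b)
    then show ?thesis
      using * by auto
  qed
qed

lemma correct_output_exists: "\<exists>r. correct_output n c r"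
  by (metis correct_output.simps majority_color_attained)

lemma class_card_less_if_no_monochromatic:
  assumes "\<And>Q. Q \<subseteq> balls n \<Longrightarrow> card Q = k \<Longrightarrow> \<not> monochromatic c Q"
  shows "card (color_class n c x) < k"
proof (rule ccontr)
  assume "\<not> ?thesis"
  then obtain Q where "Q \<subseteq> color_class n c x" "card Q = k"
    by (meson not_less obtain_subset_with_card_n)
  then show False
    using assms[of Q] by (auto simp: monochromatic_def)
qed

section \<open>Colorings given by their set of red balls\<close>

abbreviation red_on :: "nat set \<Rightarrow> nat \<Rightarrow> color" where
  "red_on S b \<equiv> if b \<in> S then Red else Blue"

lemma color_class_red_on:
  assumes "S \<subseteq> balls n"
  shows "color_class n (red_on S) Red = S" "color_class n (red_on S) Blue = balls n - S"
  using assms by auto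

lemma majority_color_red_on:
  assumes "S \<subseteq> balls n"
  shows "majority_color n (red_on S) Red \<longleftrightarrow> n < 2 * card S"
    and "majority_color n (red_on S) Blue \<longleftrightarrow> 2 * card S < n"
proof -
  show "majority_color n (red_on S) Red \<longleftrightarrow> n < 2 * card S"
    using assms unfolding majority_color_iff by (subst color_class_red_on) auto
  have "card (balls n - S) = n - card S" "card S \<le> n"
    using assms card_mono[OF _ assms] by (auto simp: card_Diff_subset finite_subset)
  then show "majority_color n (red_on S) Blue \<longleftrightarrow> 2 * card S < n"
    using assms unfolding majority_color_iff by (subst color_class_red_on) auto
qed

section \<open>The Y/N model\<close>

lemma compatible_yn_iff:
  "compatible yn_model k n h c \<longleftrightarrow>
    (\<forall>Q. Q \<subseteq> balls n \<longrightarrow> card Q = k \<longrightarrow> (h Q = YES \<longleftrightarrow> monochromatic c Q))"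
proof -
  have "yn_model c Q a \<longleftrightarrow> (a = YES \<longleftrightarrow> monochromatic c Q)" for Q a
    by (cases a) auto
  then show ?thesis
    by (simp add: compatible_def)
qed

lemma yn_answers_determine_output:
  assumes k: "k \<ge> 3" and n: "n \<ge> 2 * k - 2"
    and same: "\<And>Q. Q \<subseteq> balls n \<Longrightarrow> card Q = k \<Longrightarrow> monochromatic c Q = monochromatic c' Q"
  shows "correct_output n c r \<longleftrightarrow> correct_output n c' r"
proof (cases "\<exists>Q. Q \<subseteq> balls n \<and> card Q = k \<and> monochromatic c Q")
  case True
  then obtain Q where Q: "Q \<subseteq> balls n" "card Q = k" "monochromatic c Q" "monochromatic c' Q"
    using same by blast
  have "finite Q"
    using finite_subset[OF Q(1)] by simp
  obtain u where u: "u \<in> Q"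
    using Q(2) k by fastforce
  have "card (Q - {u}) = k - 1"
    using Q(2) u by simp
  then have "Q - {u} \<noteq> {}"
    using k by (intro notI) simp
  then obtain v where v: "v \<in> Q" "v \<noteq> u"
    by blast
  have agree: "(c x = c u) = (c' x = c' u)" if x: "x \<in> balls n" for x
  proof (cases "x \<in> Q")
    case True
    then show ?thesis
      using Q u unfolding monochromatic_def by blast
  next
    case False
    \<comment> \<open>\<open>v\<close> is exchanged for \<open>x\<close> while \<open>u\<close>
      stays, so the answer to \<open>Q'\<close> tells whether \<open>x\<close> has the color of
      \<open>Q\<close>.\<close>
    define Q' where "Q' = insert x (Q - {v})"
    have "card Q' = k" "Q' \<subseteq> balls n"
      unfolding Q'_def using False v \<open>finite Q\<close> Q x k by auto
    then have "monochromatic c Q' = monochromatic c' Q'"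
      by (rule same[rotated])
    moreover have "monochromatic d Q' \<longleftrightarrow> d x = d u" if "monochromatic d Q" for d
    proof
      assume "monochromatic d Q'"
      then show "d x = d u"
        using u v unfolding monochromatic_def Q'_def by blast
    next
      assume "d x = d u"
      then have "d y = d u" if "y \<in> Q'" for y
        using that \<open>monochromatic d Q\<close> u unfolding monochromatic_def Q'_def by blast
      then show "monochromatic d Q'"
        by (simp add: monochromatic_def)
    qed
    ultimately show ?thesis
      using Q by simp
  qed
  show ?thesis
    by (rule correct_output_cong) (rule color_eq_cong[OF agree agree])
next
  case False
  have "\<not> majority_color n d x"
    if "\<And>Q. Q \<subseteq> balls n \<Longrightarrow> card Q = k \<Longrightarrow> \<not> monochromatic d Q" for d x
    using class_card_less_if_no_monochromatic[of n k d x, OF that] n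
    unfolding majority_color_iff by linarith
  then have "\<not> majority_color n c x" "\<not> majority_color n c' x" for x
    using False same by blast+
  then show ?thesis
    by (cases r) auto
qed

lemma yn_solvable:
  assumes "k \<ge> 3" "n \<ge> 2 * k - 2"
  shows "\<exists>r. \<forall>c. compatible yn_model k n h c \<longrightarrow> correct_output n c r"
proof (cases "\<exists>c. compatible yn_model k n h c")
  case True
  then obtain c where c: "compatible yn_model k n h c" ..
  obtain r where r: "correct_output n c r"
    using correct_output_exists by blast
  have "correct_output n c' r" if "compatible yn_model k n h c'" for c'
    using yn_answers_determine_output[OF assms, of c c' r] c that r
    by (simp add: compatible_yn_iff)
  then show ?thesis
    by blast
qed auto

lemma yn_unsolvable:
  assumes "n \<ge> 2" "n < 2 * k - 2"
  shows "\<exists>c. compatible yn_model k n (\<lambda>_. NO) c \<and> \<not> correct_output n c r"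
proof -
  \<comment> \<open>The last condition bounds the blue class: \<open>n - card S < k\<close>.\<close>
  have compat: "compatible yn_model k n (\<lambda>_. NO) (red_on S)"
    if S: "S \<subseteq> balls n" "card S < k" "n < k + card S" for S
    unfolding compatible_yn_iff
  proof (intro allI impI)
    fix Q assume Q: "Q \<subseteq> balls n" "card Q = k"
    have "finite S"
      using finite_subset[OF S(1)] by simp
    have "\<not> Q \<subseteq> S"
      using card_mono[OF \<open>finite S\<close>, of Q] Q S by auto
    moreover have "\<not> Q \<subseteq> balls n - S"
      using card_mono[of "balls n - S" Q] Q S \<open>finite S\<close> by (auto simp: card_Diff_subset)
    ultimately have "\<not> monochromatic (red_on S) Q"
      using Q(1) unfolding monochromatic_def by (auto split: if_splits)
    then show "(NO = YES) = monochromatic (red_on S) Q"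
      by simp
  qed
  show ?thesis
  proof (cases "\<exists>b. r = Some b \<and> b \<in> balls n")
    case True
    then obtain b where b: "r = Some b" "b \<in> balls n"
      by blast
    \<comment> \<open>Coloring at least half of the balls red, but not \<open>b\<close>, puts
      \<open>b\<close> into a class without majority. Such a set exists because
      \<open>n \<ge> 2\<close>.\<close>
    have "(n + 1) div 2 \<le> card (balls n - {b})"
      using b assms by simp
    then obtain S where S: "S \<subseteq> balls n - {b}" "card S = (n + 1) div 2"
      by (meson obtain_subset_with_card_n)
    then have "S \<subseteq> balls n" "b \<notin> S"
      by auto
    then have "\<not> correct_output n (red_on S) r"
      using S b majority_color_red_on[of S n] by auto
    moreover have "compatible yn_model k n (\<lambda>_. NO) (red_on S)"
      using \<open>S \<subseteq> balls n\<close> S(2) assms by (intro compat) auto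
    ultimately show ?thesis
      by blast
  next
    case False
    have "n div 2 + 1 \<le> card (balls n)"
      using assms by simp
    then obtain S where S: "S \<subseteq> balls n" "card S = n div 2 + 1"
      by (meson obtain_subset_with_card_n)
    have "majority_color n (red_on S) Red"
      using S majority_color_red_on[of S n] by auto
    then have "\<not> correct_output n (red_on S) r"
      using False by (cases r) auto
    moreover have "compatible yn_model k n (\<lambda>_. NO) (red_on S)"
      using S assms by (intro compat) auto
    ultimately show ?thesis
      by blast
  qed
qed

section \<open>The Pairing model\<close>

text \<open>Forgetting the revealed pairs turns the answers into Y/N answers for the same
  coloring.\<close>

lemma pairing_solvable_if_yn_solvable:
  assumes "\<And>h. \<exists>r. \<forall>c. compatible yn_model k n h c \<longrightarrow> correct_output n c r"
  shows "\<exists>r. \<forall>c. compatible pairing_model k n h c \<longrightarrow> correct_output n c r"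
proof -
  define h' where "h' Q = (case h Q of PYES \<Rightarrow> YES | PNO _ \<Rightarrow> NO)" for Q
  have "pairing_model c Q a \<Longrightarrow> yn_model c Q (case a of PYES \<Rightarrow> YES | PNO _ \<Rightarrow> NO)" for c Q a
    by (cases a) auto
  then have "compatible yn_model k n h' c" if "compatible pairing_model k n h c" for c
    using that by (simp add: compatible_def h'_def)
  then show ?thesis
    using assms[of h'] by blast
qed

lemma pairing_unsolvable:
  assumes "n \<ge> 2" "n < 2 * k - 3"
  shows "\<exists>h. \<forall>r. \<exists>c. compatible pairing_model k n h c \<and> \<not> correct_output n c r"
proof -
  define a where "a = (n - 2) div 2"
  define A where "A = {1..a}"
  define B where "B = {a + 1..2 * a}"
  \<comment> \<open>Two or three balls remain outside \<open>A\<close> and \<open>B\<close>. By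
    \<open>n - a < k\<close>, no query can avoid \<open>A\<close> or avoid \<open>B\<close>.\<close>
  have a: "2 * a + 2 \<le> n" "n \<le> 2 * a + 3" "n - a < k"
    using assms unfolding a_def by auto
  have AB: "A \<subseteq> balls n" "B \<subseteq> balls n" "A \<inter> B = {}" "card A = a" "card B = a" "finite A" "finite B"
    using a by (auto simp: A_def B_def balls_def)
  define h where "h Q = PNO {SOME x. x \<in> Q \<inter> A, SOME y. y \<in> Q \<inter> B}" for Q
  have meets: "(SOME x. x \<in> Q \<inter> D) \<in> Q \<inter> D"
    if "Q \<subseteq> balls n" "card Q = k" "D \<subseteq> balls n" "card D = a" for Q D
  proof -
    have "\<not> Q \<subseteq> balls n - D"
      using card_mono[of "balls n - D" Q] that a finite_subset[of D "balls n"]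
      by (auto simp: card_Diff_subset)
    then have "\<exists>x. x \<in> Q \<inter> D"
      using that by auto
    then show ?thesis
      by (rule someI_ex)
  qed
  \<comment> \<open>Each revealed pair has one ball in \<open>A\<close> and one in \<open>B\<close>,
    so the remaining balls may be colored at will.\<close>
  have compat: "compatible pairing_model k n h (red_on S)" if S: "A \<subseteq> S" "S \<inter> B = {}" for S
    unfolding compatible_def
  proof (intro allI impI)
    fix Q assume Q: "Q \<subseteq> balls n" "card Q = k"
    define x where "x = (SOME x. x \<in> Q \<inter> A)"
    define y where "y = (SOME y. y \<in> Q \<inter> B)"
    have "x \<in> Q" "x \<in> S" "y \<in> Q" "y \<notin> S"
      using meets[OF Q, of A] meets[OF Q, of B] AB S unfolding x_def y_def by auto
    moreover have "h Q = PNO {x, y}"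
      by (simp add: h_def x_def y_def)
    ultimately show "pairing_model (red_on S) Q (h Q)"
      by (auto simp: monochromatic_def)
  qed
  have "\<exists>S. A \<subseteq> S \<and> S \<inter> B = {} \<and> \<not> correct_output n (red_on S) r" for r
  proof -
    have nB: "card (balls n - B) = n - a" "A \<subseteq> balls n - B" "(balls n - B) \<inter> B = {}"
      using AB by (auto simp: card_Diff_subset)
    show ?thesis
    proof (cases r)
      case None
      have "majority_color n (red_on (balls n - B)) Red"
        using majority_color_red_on[of "balls n - B" n] nB a by auto
      then show ?thesis
        using nB None by (intro exI[of _ "balls n - B"]) auto
    next
      case (Some b)
      consider "b \<notin> balls n" | "b \<in> A" | "b \<in> B" | "b \<in> balls n" "b \<notin> A" "b \<notin> B"
        by blast
      then show ?thesis
      proof cases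
        case 1
        then show ?thesis
          using Some AB by (intro exI[of _ A]) auto
      next
        case 2
        then show ?thesis
          using Some AB a majority_color_red_on[of A n] by (intro exI[of _ A]) auto
      next
        case 3
        then show ?thesis
          using Some nB a majority_color_red_on[of "balls n - B" n]
          by (intro exI[of _ "balls n - B"]) auto
      next
        \<comment> \<open>With \<open>b\<close> as the only red ball outside \<open>A\<close>, its
          class has \<open>a + 1\<close> balls, which is at most \<open>n / 2\<close>.\<close>
        case 4
        then have "card (insert b A) = a + 1" "insert b A \<subseteq> balls n"
          using AB by auto
        then show ?thesis
          using 4 Some AB a majority_color_red_on[of "insert b A" n]
          by (intro exI[of _ "insert b A"]) auto
      qed
    qed
  qed
  then show ?thesis
    using compat by blast
qed

text \<open>\<open>E\<close> is the graph of revealed pairs and \<open>F\<close> a family of proper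
  2-colorings with the largest possible red class. An exchange argument applies: a flip that
  enlarges the red class of a member of \<open>F\<close> contradicts \<open>bound\<close>.\<close>

lemma common_majority_ball:
  fixes F :: "(nat \<Rightarrow> color) set" and E :: "nat \<Rightarrow> nat \<Rightarrow> bool"
  assumes proper: "\<And>c x y. c \<in> F \<Longrightarrow> E x y \<Longrightarrow> c x \<noteq> c y"
    and red: "\<And>c. c \<in> F \<Longrightarrow> card (color_class n c Red) = k"
    and n: "n < 2 * k"
    and bound: "\<And>c. (\<And>x y. E x y \<Longrightarrow> c x \<noteq> c y) \<Longrightarrow> card (color_class n c Red) \<le> k"
    and "F \<noteq> {}"
  shows "\<exists>b\<in>balls n. \<forall>c\<in>F. c b = Red"
proof -
  define p where "p b = {c \<in> F. c b = Red}" for b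
  define N where "N X = {b \<in> balls n. p b = X}" for X
  have pF: "p b \<subseteq> F" for b
    by (auto simp: p_def)
  have finN: "finite (N X)" for X
    by (simp add: N_def)
  have compl: "p y = F - p x" if "E x y" for x y
    using proper[OF _ that] by (auto simp: p_def) (metis color.exhaust)+
  obtain c0 where c0: "c0 \<in> F"
    using \<open>F \<noteq> {}\<close> by blast
  \<comment> \<open>Otherwise, for \<open>c0\<close> in \<open>F\<close>, summing over the sets
    \<open>X\<close> that contain \<open>c0\<close> gives at least as many blue as red
    balls.\<close>
  have "\<exists>X\<subseteq>F. card (N (F - X)) < card (N X)"
  proof (rule ccontr)
    assume "\<not> ?thesis"
    then have le: "card (N X) \<le> card (N (F - X))" if "X \<subseteq> F" for X
      using that by (meson not_le)
    \<comment> \<open>\<open>T\<close> is finite even if \<open>F\<close> is not. A ball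
      \<open>b\<close> is red under \<open>c0\<close> iff \<open>c0\<close> lies in
      \<open>p b\<close>, so the \<open>N Y\<close> with \<open>Y\<close> in \<open>T\<close>
      partition the red balls of \<open>c0\<close>.\<close>
    define T where "T = {Y \<in> p ` balls n \<union> (\<lambda>b. F - p b) ` balls n. c0 \<in> Y}"
    have finT: "finite T"
      by (simp add: T_def)
    have TF: "Y \<subseteq> F" if "Y \<in> T" for Y
      using that pF by (auto simp: T_def)
    have "color_class n c0 Red = (\<Union>Y\<in>T. N Y)"
      using c0 by (auto simp: N_def T_def p_def)
    also have "card \<dots> = (\<Sum>Y\<in>T. card (N Y))"
      using finT finN by (intro card_UN_disjoint) (auto simp: N_def)
    also have "\<dots> \<le> (\<Sum>Y\<in>T. card (N (F - Y)))"
      using le TF by (intro sum_mono) auto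
    also have "\<dots> = card (\<Union>Y\<in>T. N (F - Y))"
    proof (intro card_UN_disjoint[symmetric] ballI impI)
      fix Y Z assume "Y \<in> T" "Z \<in> T" "Y \<noteq> Z"
      then have "F - Y \<noteq> F - Z"
        using TF by (metis double_diff order_refl)
      then show "N (F - Y) \<inter> N (F - Z) = {}"
        by (auto simp: N_def)
    qed (use finT finN in auto)
    also have "\<dots> \<le> card (color_class n c0 Blue)"
    proof (rule card_mono)
      show "(\<Union>Y\<in>T. N (F - Y)) \<subseteq> color_class n c0 Blue"
      proof
        fix b assume "b \<in> (\<Union>Y\<in>T. N (F - Y))"
        then have "b \<in> balls n" "c0 \<notin> p b"
          by (auto simp: N_def T_def)
        then show "b \<in> color_class n c0 Blue"
          using c0 by (cases "c0 b") (auto simp: p_def)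
      qed
    qed simp
    finally show False
      using red[OF c0] card_color_classes[of n c0] n by linarith
  qed
  then obtain X where X: "X \<subseteq> F" "card (N (F - X)) < card (N X)"
    by blast
  have "c \<in> X" if c: "c \<in> F" for c
  proof (rule ccontr)
    assume "c \<notin> X"
    \<comment> \<open>Outside \<open>X\<close>, the coloring \<open>c\<close> makes
      \<open>N X\<close> blue and \<open>N (F - X)\<close> red. The flip exchanges them and gains
      red balls.\<close>
    define d where "d b = (if p b = X \<or> p b = F - X then (if c b = Red then Blue else Red) else c b)" for b
    have "d x \<noteq> d y" if "E x y" for x y
    proof -
      \<comment> \<open>The flipped region is closed under \<open>E\<close>, because adjacent balls
        have complementary sets.\<close>
      have "p x = X \<or> p x = F - X \<longleftrightarrow> p y = X \<or> p y = F - X"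
        using compl[OF that] X(1) pF[of x] by auto
      then show ?thesis
        using proper[OF c that] by (cases "c x"; cases "c y") (auto simp: d_def)
    qed
    then have "card (color_class n d Red) \<le> k"
      by (rule bound)
    moreover have "color_class n d Red = (color_class n c Red - N (F - X)) \<union> N X"
    proof -
      have "c b \<noteq> Red" if "p b = X" for b
        using that c \<open>c \<notin> X\<close> by (auto simp: p_def)
      moreover have "c b = Red" if "p b = F - X" for b
        using that c \<open>c \<notin> X\<close> by (auto simp: p_def)
      ultimately show ?thesis
        by (auto simp: d_def N_def split: if_splits)
    qed
    moreover have "N (F - X) \<subseteq> color_class n c Red" "(color_class n c Red - N (F - X)) \<inter> N X = {}"
      using c \<open>c \<notin> X\<close> by (auto simp: N_def p_def)
    ultimately have "card (color_class n c Red) - card (N (F - X)) + card (N X) \<le> k"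
      by (simp add: card_Un_disjoint card_Diff_subset finN)
    then show False
      using X(2) red[OF c] card_mono[OF _ \<open>N (F - X) \<subseteq> color_class n c Red\<close>] by simp
  qed
  moreover obtain b where "b \<in> N X"
    using X(2) by (metis card.empty equals0I not_less_zero)
  ultimately show ?thesis
    by (auto simp: N_def p_def)
qed

lemma pairing_solvable_threshold:
  assumes "k \<ge> 3" and n: "n = 2 * k - 3"
  shows "\<exists>r. \<forall>c. compatible pairing_model k n h c \<longrightarrow> correct_output n c r"
proof (cases "\<exists>Q. Q \<subseteq> balls n \<and> card Q = k \<and> h Q = PYES")
  case True
  then obtain Q where Q: "Q \<subseteq> balls n" "card Q = k" "h Q = PYES"
    by blast
  then obtain u where u: "u \<in> Q"
    using assms by fastforce
  have "correct_output n c (Some u)" if "compatible pairing_model k n h c" for c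
  proof -
    have "pairing_model c Q PYES"
      using that Q unfolding compatible_def by metis
    then have "Q \<subseteq> color_class n c (c u)"
      using u Q(1) unfolding pairing_model.simps monochromatic_def by blast
    from card_mono[OF _ this] have "k \<le> card (color_class n c (c u))"
      using Q(2) by simp
    then show ?thesis
      using u Q(1) n assms(1) by (auto simp: majority_color_iff)
  qed
  then show ?thesis
    by blast
next
  case noYES: False
  define E where "E x y \<longleftrightarrow> (\<exists>Q \<subseteq> balls n. card Q = k \<and> x \<in> Q \<and> y \<in> Q \<and> h Q = PNO {x, y})" for x y
  \<comment> \<open>Both classes will have at most \<open>k - 1\<close> of the
    \<open>2 * k - 3\<close> balls, so their sizes are \<open>k - 1\<close> and
    \<open>k - 2\<close>. \<open>F\<close> fixes the name of the larger class as red.\<close>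
  define F where "F = {c. compatible pairing_model k n h c \<and> card (color_class n c Red) = k - 1}"
  let ?swap = "\<lambda>c b. if c b = Red then Blue else Red"
  have proper: "c x \<noteq> c y" if c: "compatible pairing_model k n h c" and E: "E x y" for c x y
  proof -
    obtain Q where "Q \<subseteq> balls n" "card Q = k" "h Q = PNO {x, y}"
      using E by (auto simp: E_def)
    then have "pairing_model c Q (PNO {x, y})"
      using c unfolding compatible_def by metis
    then show ?thesis
      by (auto simp: doubleton_eq_iff)
  qed
  have edge: "\<exists>x\<in>Q. \<exists>y\<in>Q. E x y"
    if "compatible pairing_model k n h c0" "Q \<subseteq> balls n" "card Q = k" for c0 Q
  proof -
    obtain P where P: "h Q = PNO P"
      using noYES \<open>Q \<subseteq> balls n\<close> \<open>card Q = k\<close> by (metis pairing_answer.exhaust)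
    then have "pairing_model c0 Q (PNO P)"
      using that unfolding compatible_def by metis
    then show ?thesis
      using P that by (auto simp: E_def)
  qed
  \<comment> \<open>\<open>d\<close> need not be compatible itself: \<open>c0\<close> ensures that
    every query contains an edge, and an edge already rules out a monochromatic query under
    \<open>d\<close>.\<close>
  have bound: "card (color_class n d z) \<le> k - 1"
    if c0: "compatible pairing_model k n h c0" and d: "\<And>x y. E x y \<Longrightarrow> d x \<noteq> d y" for c0 d z
  proof -
    have "\<not> monochromatic d Q" if "Q \<subseteq> balls n" "card Q = k" for Q
      using edge[OF c0 that] d unfolding monochromatic_def by blast
    from class_card_less_if_no_monochromatic[of n k d z, OF this] show ?thesis
      by simp
  qed
  have swap_compat: "compatible pairing_model k n h (?swap c)"
    if "compatible pairing_model k n h c" for c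
  proof -
    have "(?swap c x = ?swap c y) = (c x = c y)" for x y
      by (cases "c x"; cases "c y") auto
    then have "pairing_model (?swap c) Q a = pairing_model c Q a" for Q a
      by (cases a) (simp_all add: monochromatic_def)
    then show ?thesis
      using that by (simp add: compatible_def)
  qed
  have swap_class: "color_class n (?swap c) Red = color_class n c Blue" for c
    by (auto split: if_splits) (metis color.exhaust)
  have F_cases: "c \<in> F \<or> ?swap c \<in> F" if c: "compatible pairing_model k n h c" for c
  proof -
    have "card (color_class n c x) \<le> k - 1" for x
      by (rule bound[OF c]) (rule proper[OF c])
    from this[of Red] this[of Blue] card_color_classes[of n c]
    have "card (color_class n c Red) = k - 1 \<or> card (color_class n c Blue) = k - 1"
      using n by linarith
    then show ?thesis
      using c swap_compat[OF c] unfolding F_def mem_Collect_eq swap_class by blast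
  qed
  show ?thesis
  proof (cases "F = {}")
    \<comment> \<open>Every compatible coloring or its swap lies in \<open>F\<close>, so here no
      coloring is compatible and any output will do.\<close>
    case True
    then show ?thesis
      using F_cases by blast
  next
    case False
    then obtain c0 where c0: "compatible pairing_model k n h c0"
      by (auto simp: F_def)
    have "\<exists>b\<in>balls n. \<forall>c\<in>F. c b = Red"
    proof (rule common_majority_ball[where E = E and k = "k - 1"])
      show "n < 2 * (k - 1)"
        using assms by simp
      show "card (color_class n d Red) \<le> k - 1" if "\<And>x y. E x y \<Longrightarrow> d x \<noteq> d y" for d
        using bound[OF c0 that] .
    qed (use False proper in \<open>auto simp: F_def\<close>)
    then obtain b where b: "b \<in> balls n" "\<And>c. c \<in> F \<Longrightarrow> c b = Red"
      by blast
    have F_ok: "correct_output n c (Some b)" if "c \<in> F" for c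
    proof -
      have "card (color_class n c Red) = k - 1"
        using that by (simp add: F_def)
      then show ?thesis
        using b(1) b(2)[OF that] assms by (simp add: majority_color_iff)
    qed
    have "correct_output n c (Some b)" if "compatible pairing_model k n h c" for c
    proof -
      \<comment> \<open>Exchanging the color names carries the result from \<open>F\<close> to all
        compatible colorings.\<close>
      have "correct_output n (?swap c) (Some b) \<longleftrightarrow> correct_output n c (Some b)"
      proof (rule correct_output_cong)
        show "(?swap c x = ?swap c y) = (c x = c y)" for x y
          by (cases "c x"; cases "c y") auto
      qed
      then show ?thesis
        using F_cases[OF that] F_ok by blast
    qed
    then show ?thesis
      by blast
  qed
qed

theorem theorem2p1:
  fixes k n :: nat
  assumes "k \<ge> 3" and "n \<ge> 2"
  shows "((\<exists>q. is_query_number yn_model k n q) \<longleftrightarrow> n \<ge> 2 * k - 2) \<and>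
    ((\<exists>q. is_query_number pairing_model k n q) \<longleftrightarrow> n \<ge> 2 * k - 3)"
proof (intro conjI)
  show "(\<exists>q. is_query_number yn_model k n q) \<longleftrightarrow> n \<ge> 2 * k - 2"
    unfolding query_number_exists_iff
    using yn_solvable[OF assms(1)] yn_unsolvable[OF assms(2)] by (meson not_le)
  show "(\<exists>q. is_query_number pairing_model k n q) \<longleftrightarrow> n \<ge> 2 * k - 3"
    unfolding query_number_exists_iff
  proof
    assume "\<forall>h. \<exists>r. \<forall>c. compatible pairing_model k n h c \<longrightarrow> correct_output n c r"
    then show "n \<ge> 2 * k - 3"
      using pairing_unsolvable[OF assms(2)] by (meson not_le)
  next
    assume "n \<ge> 2 * k - 3"
    then consider "n = 2 * k - 3" | "n \<ge> 2 * k - 2"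
      by linarith
    then show "\<forall>h. \<exists>r. \<forall>c. compatible pairing_model k n h c \<longrightarrow> correct_output n c r"
    proof cases
      case 1
      then show ?thesis
        by (intro allI pairing_solvable_threshold assms)
    next
      case 2
      then show ?thesis
        by (intro allI pairing_solvable_if_yn_solvable yn_solvable assms)
    qed
  qed
qed

end
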